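(* Let $\mathbb{L}=\mathbb{Z}[t^{\pm1},(1-t)^{-1}]$ and $\mathbb{D}=\mathbb{Z}[1/2]$. Let $X$ be a nonempty set (of arbitrary cardinality) and fix $z\in X$. For $R\in\{\mathbb{L},\mathbb{D}\}$ let $\mathrm{FAM}_R(X):=R^{(X\setminus\{z\})}$ be the free $R$-module on the set $X\setminus\{z\}$, and let $\iota\colon X\to \mathrm{FAM}_R(X)$ send $z$ to $0$ and each $x\in X\setminus\{z\}$ to the corresponding basis element. Then $\mathrm{Alex}(\mathrm{FAM}_{\mathbb{L}}(X),\varphi)$, where $\varphi$ is multiplication by $t$, together with $\iota$, is the free medial Latin quandle generated by $X$, and $\mathrm{FAM}_{\mathbb{D}}(X)_{\mathrm{mid}}$, together with $\iota$, is the free medial commutative quandle generated by $X$. If $X$ is empty, then the free medial Latin quandle and the free medial commutative quandle generated by $X$ are the empty quandle.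
   Context: A magma $(X,\ast)$ is a set (possibly empty) with a binary operation; homomorphisms are maps preserving the operation. For $x\in X$, let $R_x\colon y\mapsto y\ast x$ and $L_x\colon y\mapsto x\ast y$. A rack is a magma in which every $R_x$ is an automorphism of the magma. A quandle is a rack with $x\ast x=x$ for all $x$. A magma is medial if $(a\ast b)\ast(c\ast d)=(a\ast c)\ast(b\ast d)$ for all $a,b,c,d$; Latin if every $L_x$ is a permutation; commutative if $x\ast y=y\ast x$ for all $x,y$. $\mathbb{L}$ is the localization of $\mathbb{Z}[t]$ inverting $t$ and $1-t$. For an abelian group $A$ and an automorphism $\varphi$ of $A$, $\mathrm{Alex}(A,\varphi)$ is the quandle on $A$ with $x\ast y:=\varphi(x)+(\mathrm{id}-\varphi)(y)$. For a $\mathbb{D}$-module $M$, $M_{\mathrm{mid}}$ is the quandle on $M$ with $x\ast y:=\frac12(x+y)$. The free medial Latin (resp. medial commutative) quandle generated by a set $X$ is a medial Latin (resp. medial commutative) quandle $F$ with an injective map $\iota\colon X\to F$ such that for every medial Latin (resp. medial commutative) quandle $Q$ and every function $f\colon X\to Q$ there is a unique quandle homomorphism $\tilde f\colon F\to Q$ with $\tilde f\circ\iota=f$. *)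

theory Defs
  imports
    "HOL-Library.Poly_Mapping"
    "HOL-Computational_Algebra.Polynomial"
    "HOL-Computational_Algebra.Fraction_Field"
    "HOL-Algebra.Congruence"
begin

section \<open>Magmas, racks and quandles\<close>

text \<open>Magmas live on an explicit carrier set, which may be empty.\<close>

record 'a magma = "'a partial_object" +
  magop :: "'a \<Rightarrow> 'a \<Rightarrow> 'a" (infixl \<open>\<star>\<index>\<close> 70)

definition is_magma :: "'a magma \<Rightarrow> bool" where
  "is_magma Q \<longleftrightarrow> (\<forall>x\<in>carrier Q. \<forall>y\<in>carrier Q. x \<star>\<^bsub>Q\<^esub> y \<in> carrier Q)"

definition magma_hom :: "'a magma \<Rightarrow> 'b magma \<Rightarrow> ('a \<Rightarrow> 'b) set" where
  "magma_hom P Q = {h \<in> carrier P \<rightarrow> carrier Q.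
     \<forall>x\<in>carrier P. \<forall>y\<in>carrier P. h (x \<star>\<^bsub>P\<^esub> y) = h x \<star>\<^bsub>Q\<^esub> h y}"

definition magma_aut :: "'a magma \<Rightarrow> ('a \<Rightarrow> 'a) set" where
  "magma_aut Q = {h \<in> magma_hom Q Q. bij_betw h (carrier Q) (carrier Q)}"

definition is_rack :: "'a magma \<Rightarrow> bool" where
  "is_rack Q \<longleftrightarrow> is_magma Q \<and> (\<forall>x\<in>carrier Q. (\<lambda>y. y \<star>\<^bsub>Q\<^esub> x) \<in> magma_aut Q)"

definition is_quandle :: "'a magma \<Rightarrow> bool" where
  "is_quandle Q \<longleftrightarrow> is_rack Q \<and> (\<forall>x\<in>carrier Q. x \<star>\<^bsub>Q\<^esub> x = x)"

definition is_medial :: "'a magma \<Rightarrow> bool" where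
  "is_medial Q \<longleftrightarrow>
     (\<forall>a\<in>carrier Q. \<forall>b\<in>carrier Q. \<forall>c\<in>carrier Q. \<forall>d\<in>carrier Q.
        (a \<star>\<^bsub>Q\<^esub> b) \<star>\<^bsub>Q\<^esub> (c \<star>\<^bsub>Q\<^esub> d) = (a \<star>\<^bsub>Q\<^esub> c) \<star>\<^bsub>Q\<^esub> (b \<star>\<^bsub>Q\<^esub> d))"

definition is_Latin :: "'a magma \<Rightarrow> bool" where
  "is_Latin Q \<longleftrightarrow> (\<forall>x\<in>carrier Q. bij_betw (\<lambda>y. x \<star>\<^bsub>Q\<^esub> y) (carrier Q) (carrier Q))"

definition is_commutative :: "'a magma \<Rightarrow> bool" where
  "is_commutative Q \<longleftrightarrow> (\<forall>x\<in>carrier Q. \<forall>y\<in>carrier Q. x \<star>\<^bsub>Q\<^esub> y = y \<star>\<^bsub>Q\<^esub> x)"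

definition medial_Latin_quandle :: "'a magma \<Rightarrow> bool" where
  "medial_Latin_quandle Q \<longleftrightarrow> is_quandle Q \<and> is_medial Q \<and> is_Latin Q"

definition medial_commutative_quandle :: "'a magma \<Rightarrow> bool" where
  "medial_commutative_quandle Q \<longleftrightarrow> is_quandle Q \<and> is_medial Q \<and> is_commutative Q"


section \<open>Free quandles\<close>

text \<open>
  A homomorphism is determined by its values on the carrier; to express its uniqueness we
  require the representing total function to be \<^const>\<open>undefined\<close> outside the carrier.
\<close>

definition universal_for ::
    "('q magma \<Rightarrow> bool) \<Rightarrow> 'x set \<Rightarrow> 'f magma \<Rightarrow> ('x \<Rightarrow> 'f) \<Rightarrow> bool" where
  "universal_for C X F i \<longleftrightarrow>
     (\<forall>Q f. C Q \<longrightarrow> f \<in> X \<rightarrow> carrier Q \<longrightarrow>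
        (\<exists>!h. h \<in> magma_hom F Q \<and> h \<in> extensional (carrier F) \<and> (\<forall>x\<in>X. h (i x) = f x)))"

text \<open>
  HOL cannot quantify over types inside a formula, so the type \<open>'q\<close> in which the test quandles
  live is a parameter; a theorem stated for a type variable \<open>'q\<close> covers test quandles of
  every type.
\<close>

definition free_medial_Latin_quandle ::
    "'q itself \<Rightarrow> 'x set \<Rightarrow> 'f magma \<Rightarrow> ('x \<Rightarrow> 'f) \<Rightarrow> bool" where
  "free_medial_Latin_quandle (_ :: 'q itself) X F i \<longleftrightarrow>
     medial_Latin_quandle F \<and> i \<in> X \<rightarrow> carrier F \<and> inj_on i X \<and>
     universal_for (medial_Latin_quandle :: 'q magma \<Rightarrow> bool) X F i"

definition free_medial_commutative_quandle ::
    "'q itself \<Rightarrow> 'x set \<Rightarrow> 'f magma \<Rightarrow> ('x \<Rightarrow> 'f) \<Rightarrow> bool" where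
  "free_medial_commutative_quandle (_ :: 'q itself) X F i \<longleftrightarrow>
     medial_commutative_quandle F \<and> i \<in> X \<rightarrow> carrier F \<and> inj_on i X \<and>
     universal_for (medial_commutative_quandle :: 'q magma \<Rightarrow> bool) X F i"


section \<open>The rings $\mathbb{Z}[t^{\pm1},(1-t)^{-1}]$ and $\mathbb{Z}[1/2]$\<close>

text \<open>
  $\mathbb{Z}[t]$ is a domain, so its localization is the subring of the fraction field consisting
  of the fractions with denominator $t^m(1-t)^n$. In \<^typ>\<open>int poly\<close>, $t$ is \<open>[:0, 1:]\<close> and
  $1-t$ is \<open>[:1, -1:]\<close>.
\<close>

typedef loc_ring = "{Fract p ([:0, 1:] ^ m * [:1, -1:] ^ n) | (p :: int poly) m n. True}"
  morphisms fract_of_loc Abs_loc_ring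
  by blast

setup_lifting type_definition_loc_ring

lemma loc_den_nonzero: "[:0, 1:] ^ m * [:1, -1:] ^ n \<noteq> (0 :: int poly)"
  by simp

lemma loc_den_mult:
  "([:0, 1:] ^ m * [:1, -1:] ^ n) * ([:0, 1:] ^ k * [:1, -1:] ^ l) =
     ([:0, 1:] ^ (m + k) * [:1, -1:] ^ (n + l) :: int poly)"
  by (simp only: power_add mult_ac)

instantiation loc_ring :: comm_ring_1
begin

lift_definition zero_loc_ring :: loc_ring is 0
  by (rule exI[of _ 0], rule exI[of _ 0], rule exI[of _ 0])
    (simp add: Zero_fract_def)

lift_definition one_loc_ring :: loc_ring is 1
  by (rule exI[of _ 1], rule exI[of _ 0], rule exI[of _ 0])
    (simp add: One_fract_def)

lift_definition uminus_loc_ring :: "loc_ring \<Rightarrow> loc_ring" is uminus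
  by (metis minus_fract)

lift_definition plus_loc_ring :: "loc_ring \<Rightarrow> loc_ring \<Rightarrow> loc_ring" is "(+)"
proof clarify
  fix p q :: "int poly" and m n k l
  show "\<exists>r a b. Fract p ([:0, 1:] ^ m * [:1, -1:] ^ n) + Fract q ([:0, 1:] ^ k * [:1, -1:] ^ l)
          = Fract r ([:0, 1:] ^ a * [:1, -1:] ^ b) \<and> True"
    by (intro exI conjI TrueI, subst add_fract[OF loc_den_nonzero loc_den_nonzero],
        rule arg_cong[where f = "Fract _"], rule loc_den_mult)
qed

lift_definition minus_loc_ring :: "loc_ring \<Rightarrow> loc_ring \<Rightarrow> loc_ring" is "(-)"
proof clarify
  fix p q :: "int poly" and m n k l
  show "\<exists>r a b. Fract p ([:0, 1:] ^ m * [:1, -1:] ^ n) - Fract q ([:0, 1:] ^ k * [:1, -1:] ^ l)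
          = Fract r ([:0, 1:] ^ a * [:1, -1:] ^ b) \<and> True"
    by (intro exI conjI TrueI, subst diff_fract[OF loc_den_nonzero loc_den_nonzero],
        rule arg_cong[where f = "Fract _"], rule loc_den_mult)
qed

lift_definition times_loc_ring :: "loc_ring \<Rightarrow> loc_ring \<Rightarrow> loc_ring" is "(*)"
proof clarify
  fix p q :: "int poly" and m n k l
  show "\<exists>r a b. Fract p ([:0, 1:] ^ m * [:1, -1:] ^ n) * Fract q ([:0, 1:] ^ k * [:1, -1:] ^ l)
          = Fract r ([:0, 1:] ^ a * [:1, -1:] ^ b) \<and> True"
    by (intro exI conjI TrueI, subst mult_fract,
        rule arg_cong[where f = "Fract _"], rule loc_den_mult)
qed

instance
  by standard (transfer; simp add: algebra_simps)+

end

lift_definition loc_t :: loc_ring is "Fract [:0, 1:] 1"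
  by (rule exI[of _ "[:0, 1:]"], rule exI[of _ 0], rule exI[of _ 0]) simp

lemma loc_t_unit: "loc_t dvd 1"
proof -
  have "\<exists>u. 1 = loc_t * u"
  proof (transfer, rule bexI)
    show "1 = Fract [:0, 1:] 1 * Fract (1 :: int poly) ([:0, 1:] ^ 1 * [:1, -1:] ^ 0)"
      by (simp add: One_fract_def eq_fract)
  qed blast
  then show ?thesis by (simp add: dvd_def)
qed

lemma one_minus_loc_t_unit: "1 - loc_t dvd 1"
proof -
  have "\<exists>u. 1 = (1 - loc_t) * u"
  proof (transfer, rule bexI)
    show "1 = (1 - Fract [:0, 1:] 1) * Fract (1 :: int poly) ([:0, 1:] ^ 0 * [:1, -1:] ^ 1)"
      by (simp add: One_fract_def eq_fract one_pCons)
  qed blast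
  then show ?thesis by (simp add: dvd_def)
qed

typedef dyadic = "{of_int a / 2 ^ n | (a :: int) n. True} :: rat set"
  morphisms rat_of_dyadic Abs_dyadic
  by blast

setup_lifting type_definition_dyadic

instantiation dyadic :: comm_ring_1
begin

lift_definition zero_dyadic :: dyadic is 0
  by (rule exI[of _ 0], rule exI[of _ 0]) simp

lift_definition one_dyadic :: dyadic is 1
  by (rule exI[of _ 1], rule exI[of _ 0]) simp

lift_definition uminus_dyadic :: "dyadic \<Rightarrow> dyadic" is uminus
  by (metis minus_divide_left of_int_minus)

lift_definition plus_dyadic :: "dyadic \<Rightarrow> dyadic \<Rightarrow> dyadic" is "(+)"
proof clarify
  fix a b :: int and m n :: nat
  have "of_int a / 2 ^ m + of_int b / 2 ^ n = (of_int (a * 2 ^ n + b * 2 ^ m) / 2 ^ (m + n) :: rat)"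
    by (simp add: field_simps power_add)
  then show "\<exists>c k. of_int a / 2 ^ m + of_int b / 2 ^ n = (of_int c / 2 ^ k :: rat) \<and> True"
    by blast
qed

lift_definition minus_dyadic :: "dyadic \<Rightarrow> dyadic \<Rightarrow> dyadic" is "(-)"
proof clarify
  fix a b :: int and m n :: nat
  have "of_int a / 2 ^ m - of_int b / 2 ^ n = (of_int (a * 2 ^ n - b * 2 ^ m) / 2 ^ (m + n) :: rat)"
    by (simp add: field_simps power_add)
  then show "\<exists>c k. of_int a / 2 ^ m - of_int b / 2 ^ n = (of_int c / 2 ^ k :: rat) \<and> True"
    by blast
qed

lift_definition times_dyadic :: "dyadic \<Rightarrow> dyadic \<Rightarrow> dyadic" is "(*)"
proof clarify
  fix a b :: int and m n :: nat
  have "of_int a / 2 ^ m * (of_int b / 2 ^ n) = (of_int (a * b) / 2 ^ (m + n) :: rat)"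
    by (simp add: field_simps power_add)
  then show "\<exists>c k. of_int a / 2 ^ m * (of_int b / 2 ^ n) = (of_int c / 2 ^ k :: rat) \<and> True"
    by blast
qed

instance
  by standard (transfer; simp add: algebra_simps)+

end

lift_definition dyadic_half :: dyadic is "1 / 2"
  by (rule exI[of _ 1], rule exI[of _ 1]) simp

lemma dyadic_half_plus_half: "dyadic_half + dyadic_half = 1"
  by transfer simp


section \<open>Free modules\<close>

definition fscale :: "'r \<Rightarrow> ('a \<Rightarrow>\<^sub>0 'r) \<Rightarrow> ('a \<Rightarrow>\<^sub>0 'r :: comm_ring_1)" where
  "fscale c v = Poly_Mapping.map ((*) c) v"

lemma lookup_fscale: "Poly_Mapping.lookup (fscale c v) x = c * Poly_Mapping.lookup v x"
  by (simp add: fscale_def map.rep_eq when_def)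

lemma module_fscale: "module fscale"
  by standard (auto intro!: poly_mapping_eqI simp: lookup_fscale lookup_add algebra_simps)

text \<open>$R^{(X\setminus\{z\})}$, the submodule of functions supported in $X\setminus\{z\}$.\<close>

definition FAM :: "'a set \<Rightarrow> 'a \<Rightarrow> ('a \<Rightarrow>\<^sub>0 'r :: comm_ring_1) set" where
  "FAM X z = {v. Poly_Mapping.keys v \<subseteq> X - {z}}"

lemma mem_FAM_iff: "v \<in> FAM X z \<longleftrightarrow> (\<forall>x. x \<notin> X - {z} \<longrightarrow> Poly_Mapping.lookup v x = 0)"
  unfolding FAM_def subset_iff in_keys_iff mem_Collect_eq by blast

lemma subspace_FAM: "module.subspace fscale (FAM X z)"
  unfolding module.subspace_def[OF module_fscale]
  by (simp add: mem_FAM_iff lookup_fscale lookup_add)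

definition FAM_incl :: "'a \<Rightarrow> 'a \<Rightarrow> ('a \<Rightarrow>\<^sub>0 'r :: comm_ring_1)" where
  "FAM_incl z x = (if x = z then 0 else Poly_Mapping.single x 1)"


section \<open>Alexander quandles and midpoint quandles\<close>

definition Alex :: "'g :: ab_group_add set \<Rightarrow> ('g \<Rightarrow> 'g) \<Rightarrow> 'g magma" where
  "Alex A \<phi> = \<lparr>carrier = A, magop = (\<lambda>x y. \<phi> x + (y - \<phi> y))\<rparr>"

text \<open>\<open>scale\<close> is the scalar multiplication of the $\mathbb{Z}[1/2]$-module \<open>M\<close>.\<close>

definition midpoint_quandle ::
    "(dyadic \<Rightarrow> 'm \<Rightarrow> 'm) \<Rightarrow> 'm :: ab_group_add set \<Rightarrow> 'm magma" where
  "midpoint_quandle scale M = \<lparr>carrier = M, magop = (\<lambda>x y. scale dyadic_half (x + y))\<rparr>"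

end

theory Submission
  imports Defs "HOL-Algebra.FiniteProduct"
begin

text \<open>
  Fix a test quandle \<open>Q\<close> and let \<open>e\<close> be the prescribed image of \<open>z\<close>. If \<open>Q\<close> were an Alexander
  quandle with zero \<open>e\<close>, then \<open>x \<star> e\<close> would be \<open>\<phi> x\<close> and \<open>e \<star> y\<close> would be \<open>y - \<phi> y\<close>, so that
  \<open>(x \<star> e) + (e \<star> y) = x \<star> y\<close>. In a medial Latin quandle both translations at \<open>e\<close> are
  bijective and this equation can be taken as the definition of an addition. Mediality turns into the
  interchange law for it, and the Eckmann-Hilton argument shows that the addition makes \<open>Q\<close> an
  abelian group with zero \<open>e\<close> (\<open>comm_group_grp\<close>). The translation \<open>x \<mapsto> x \<star> e\<close> is an automorphism
  \<open>t\<close> of this group, and \<open>1 - t\<close> is the translation \<open>y \<mapsto> e \<star> y\<close>, also invertible. Hence the group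
  is a module over \<open>\<int>[t]\<close>, and over its localization at \<open>t\<close> and \<open>1 - t\<close> (\<open>loc_ring_action\<close>). If \<open>Q\<close>
  is commutative, then \<open>t = 1 - t\<close>, so \<open>t\<close> is the inverse of doubling and the group is a module over
  \<open>\<int>[1/2]\<close> (\<open>dyadic_action\<close>).

  From here both cases are one. The midpoint quandle is the Alexander quandle of multiplication by
  \<open>1/2\<close>, so there is a coefficient ring with a distinguished element \<open>c\<close>, equal to \<open>t\<close> or \<open>1/2\<close>, which
  acts as the translation at \<open>e\<close>. A map from \<open>Alex M c\<close> to \<open>Q\<close> that sends \<open>0\<close> to \<open>e\<close> is a quandle
  homomorphism if and only if it is linear (\<open>linear_imp_hom\<close>, \<open>hom_imp_linear\<close>); for the direction from
  homomorphisms to linear maps one needs that \<open>c\<close> generates the ring, with inverses of units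
  allowed. As \<open>\<iota> z = 0\<close> is sent to \<open>e\<close>, the universal property of the free quandle is that of the free
  module on \<open>X \<setminus> {z}\<close> (\<open>universal_for_Alex\<close>).
\<close>

section \<open>Ring actions on abelian groups\<close>

text \<open>
  A module over \<open>'r\<close> whose underlying abelian group is an arbitrary carrier set. The group is
  written multiplicatively, so \<open>\<otimes>\<close> is addition of module elements and \<open>\<one>\<close> is the zero vector.
\<close>

locale ring_action = comm_group G for G (structure) +
  fixes act :: "'r::comm_ring_1 \<Rightarrow> 'a \<Rightarrow> 'a"
  assumes act_closed [simp]: "x \<in> carrier G \<Longrightarrow> act r x \<in> carrier G"
    and act_mult: "x \<in> carrier G \<Longrightarrow> y \<in> carrier G \<Longrightarrow> act r (x \<otimes> y) = act r x \<otimes> act r y"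
    and act_add: "x \<in> carrier G \<Longrightarrow> act (r + s) x = act r x \<otimes> act s x"
    and act_times: "x \<in> carrier G \<Longrightarrow> act (r * s) x = act r (act s x)"
    and act_one [simp]: "x \<in> carrier G \<Longrightarrow> act 1 x = x"
begin

lemma act_unit [simp]: "act r \<one> = \<one>"
  by (metis act_closed act_mult l_cancel_one' one_closed r_one)

lemma act_zero [simp]: "x \<in> carrier G \<Longrightarrow> act 0 x = \<one>"
  by (metis act_add act_closed add_0 l_cancel_one)

lemma act_commute: "x \<in> carrier G \<Longrightarrow> act r (act s x) = act s (act r x)"
  by (metis act_times mult.commute)

lemma bij_act_times:
  assumes "bij_betw (act r) (carrier G) (carrier G)" "bij_betw (act s) (carrier G) (carrier G)"
  shows "bij_betw (act (r * s)) (carrier G) (carrier G)"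
proof -
  have "bij_betw (act r \<circ> act s) (carrier G) (carrier G)"
    using assms by (blast intro: bij_betw_trans)
  then show ?thesis
    by (rule bij_betw_cong[THEN iffD1, rotated]) (simp add: act_times)
qed

lemma bij_act_power:
  assumes "bij_betw (act r) (carrier G) (carrier G)"
  shows "bij_betw (act (r ^ n)) (carrier G) (carrier G)"
proof (induction n)
  case 0
  have "bij_betw id (carrier G) (carrier G)" by simp
  then show ?case by (rule bij_betw_cong[THEN iffD1, rotated]) simp
next
  case (Suc n)
  then show ?case using assms by (simp add: bij_act_times)
qed

end

lemma (in comm_group) int_ring_action: "ring_action G (\<lambda>(k::int) x. x [^] k)"
  by unfold_locales (auto simp: int_pow_distrib int_pow_mult int_pow_pow mult.commute)

context ring_action
begin

text \<open>
  Evaluating a polynomial at an endomorphism \<open>T\<close> that commutes with the scalars, by Horner's rule.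
\<close>

definition poly_act :: "('a \<Rightarrow> 'a) \<Rightarrow> 'r poly \<Rightarrow> 'a \<Rightarrow> 'a" where
  "poly_act T p x = fold_coeffs (\<lambda>a y. act a x \<otimes> T y) p \<one>"

context
  fixes T
  assumes T_hom: "T \<in> hom G G"
    and T_act: "\<And>r x. x \<in> carrier G \<Longrightarrow> T (act r x) = act r (T x)"
begin

lemma T_closed [simp]: "x \<in> carrier G \<Longrightarrow> T x \<in> carrier G"
  using T_hom by (auto simp: hom_def)

lemma T_mult: "x \<in> carrier G \<Longrightarrow> y \<in> carrier G \<Longrightarrow> T (x \<otimes> y) = T x \<otimes> T y"
  using T_hom by (auto simp: hom_def)

lemma T_unit [simp]: "T \<one> = \<one>"
  by (metis T_closed T_mult l_cancel_one' one_closed r_one)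

lemma poly_act_0 [simp]: "poly_act T 0 x = \<one>"
  by (simp add: poly_act_def)

lemma poly_act_pCons:
  "x \<in> carrier G \<Longrightarrow> poly_act T (pCons a p) x = act a x \<otimes> T (poly_act T p x)"
  by (cases "a = 0 \<and> p = 0") (auto simp: poly_act_def)

lemma poly_act_closed [simp]: "x \<in> carrier G \<Longrightarrow> poly_act T p x \<in> carrier G"
  by (induction p) (auto simp: poly_act_pCons)

lemma poly_act_smult:
  "x \<in> carrier G \<Longrightarrow> poly_act T (smult a p) x = act a (poly_act T p x)"
  by (induction p) (auto simp: poly_act_pCons act_mult act_times T_act)

lemma poly_act_add:
  "x \<in> carrier G \<Longrightarrow> poly_act T (p + q) x = poly_act T p x \<otimes> poly_act T q x"
  by (induction p q rule: poly_induct2) (auto simp: poly_act_pCons act_add T_mult m_ac)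

lemma poly_act_times:
  "x \<in> carrier G \<Longrightarrow> poly_act T (p * q) x = poly_act T p (poly_act T q x)"
  by (induction p) (auto simp: poly_act_pCons poly_act_smult poly_act_add)

lemma poly_act_mult:
  "x \<in> carrier G \<Longrightarrow> y \<in> carrier G \<Longrightarrow>
    poly_act T p (x \<otimes> y) = poly_act T p x \<otimes> poly_act T p y"
  by (induction p) (auto simp: poly_act_pCons act_mult T_mult m_ac)

lemma poly_ring_action: "ring_action G (poly_act T)"
  by unfold_locales
    (auto simp: poly_act_mult poly_act_add poly_act_times poly_act_pCons one_pCons)

lemma poly_act_X: "x \<in> carrier G \<Longrightarrow> poly_act T [:0, 1:] x = T x"
  by (simp add: poly_act_pCons)

end

text \<open>
  The universal property of localization, for actions. If the denominator \<open>d\<close> of a fraction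
  \<open>s = p/d\<close> acts bijectively, then \<open>s\<close> must send \<open>x\<close> to the \<open>y\<close> with \<open>d y = p x\<close>. Since \<open>\<psi>\<close> is
  injective, cross multiplication shows that the same \<open>y\<close> works for every representation of \<open>s\<close>
  as a fraction, and the action laws follow by clearing denominators.
\<close>

lemma extend_to_localization:
  fixes \<psi> :: "'r \<Rightarrow> 's::comm_ring_1"
  assumes inj: "inj \<psi>"
    and \<psi>_add: "\<And>a b. \<psi> (a + b) = \<psi> a + \<psi> b"
    and \<psi>_times: "\<And>a b. \<psi> (a * b) = \<psi> a * \<psi> b"
    and \<psi>_one: "\<psi> 1 = 1"
    and fraction: "\<And>s. \<exists>p d. bij_betw (act d) (carrier G) (carrier G) \<and> \<psi> d * s = \<psi> p"
  obtains act' where "ring_action G act'" "\<And>r x. x \<in> carrier G \<Longrightarrow> act' (\<psi> r) x = act r x"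
proof -
  have ex: "\<exists>y\<in>carrier G. \<forall>d p. \<psi> d * s = \<psi> p \<longrightarrow> act d y = act p x"
    if x: "x \<in> carrier G" for s x
  proof -
    obtain p0 d0 where bij: "bij_betw (act d0) (carrier G) (carrier G)" and 0: "\<psi> d0 * s = \<psi> p0"
      using fraction by blast
    obtain y where y: "y \<in> carrier G" "act d0 y = act p0 x"
      using bij x by (metis act_closed bij_betw_imp_surj_on imageE)
    have "act d y = act p x" if "\<psi> d * s = \<psi> p" for d p
    proof -
      have "\<psi> (d * p0) = \<psi> (d0 * p)"
        by (simp add: \<psi>_times flip: 0 that)
      then have "d * p0 = d0 * p" using inj by (auto dest: injD)
      then have "act d0 (act d y) = act d0 (act p x)"
        using x y by (metis act_commute act_times)
      then show ?thesis
        using bij x y by (auto simp: bij_betw_def dest: inj_onD)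
    qed
    then show ?thesis using y by blast
  qed
  define act' where
    "act' s x = (SOME y. y \<in> carrier G \<and> (\<forall>d p. \<psi> d * s = \<psi> p \<longrightarrow> act d y = act p x))" for s x
  have spec: "act' s x \<in> carrier G \<and> (\<forall>d p. \<psi> d * s = \<psi> p \<longrightarrow> act d (act' s x) = act p x)"
    if "x \<in> carrier G" for s x
    unfolding act'_def by (rule someI_ex) (use ex[OF that, of s] in auto)
  then have act'_closed: "act' s x \<in> carrier G" if "x \<in> carrier G" for s x
    using that by blast
  have act': "act d (act' s x) = act p x" if "x \<in> carrier G" "\<psi> d * s = \<psi> p" for s x d p
    using spec that by blast
  have eqI: "act' s x = y"
    if "x \<in> carrier G" "y \<in> carrier G" "bij_betw (act d) (carrier G) (carrier G)"
      "\<psi> d * s = \<psi> p" "act d y = act p x" for s x y d p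
  proof (rule inj_onD)
    show "inj_on (act d) (carrier G)" using that(3) by (rule bij_betw_imp_inj_on)
    show "act d (act' s x) = act d y" using act'[OF that(1,4)] that(5) by simp
  qed (use that act'_closed in auto)
  have bij_one: "bij_betw (act 1) (carrier G) (carrier G)"
    using bij_act_power[where n = 0 and r = 1] by (simp add: bij_betw_def inj_on_def)
  have extends: "act' (\<psi> r) x = act r x" if "x \<in> carrier G" for r x
    using that by (intro eqI[OF _ _ bij_one]) (auto simp: \<psi>_one)
  have "ring_action G act'"
  proof unfold_locales
    fix x s assume x: "x \<in> carrier G"
    show "act' s x \<in> carrier G" using x by (rule act'_closed)
    show "act' 1 x = x" using extends[OF x, of 1] x by (simp add: \<psi>_one)
    obtain p d where d: "bij_betw (act d) (carrier G) (carrier G)" "\<psi> d * s = \<psi> p"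
      using fraction by blast
    show "act' s (x \<otimes> y) = act' s x \<otimes> act' s y" if y: "y \<in> carrier G" for y
      using x y d by (intro eqI[where d = d and p = p]) (auto simp: act_mult act' act'_closed)
    fix r
    obtain q c where c: "bij_betw (act c) (carrier G) (carrier G)" "\<psi> c * r = \<psi> q"
      using fraction by blast
    have "bij_betw (act (c * d)) (carrier G) (carrier G)"
      using c d by (simp add: bij_act_times)
    note eqI' = eqI[OF _ _ this]
    show "act' (r + s) x = act' r x \<otimes> act' s x"
    proof (rule eqI')
      have "\<psi> (c * d) * (r + s) = \<psi> d * (\<psi> c * r) + \<psi> c * (\<psi> d * s)"
        by (simp add: \<psi>_times algebra_simps)
      then show "\<psi> (c * d) * (r + s) = \<psi> (d * q + c * p)"
        by (simp only: c d \<psi>_times \<psi>_add)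
      have "act (c * d) (act' r x) = act (d * q) x"
        by (simp add: mult.commute[of c d] act_times act'[OF x c(2)] act'_closed x)
      moreover have "act (c * d) (act' s x) = act (c * p) x"
        by (simp add: act_times act'[OF x d(2)] act'_closed x)
      ultimately show "act (c * d) (act' r x \<otimes> act' s x) = act (d * q + c * p) x"
        using x by (simp add: act_mult act_add act'_closed)
    qed (use x in \<open>auto simp: act'_closed\<close>)
    show "act' (r * s) x = act' r (act' s x)"
    proof (rule eqI')
      have "\<psi> (c * d) * (r * s) = (\<psi> c * r) * (\<psi> d * s)"
        by (simp add: \<psi>_times algebra_simps)
      then show "\<psi> (c * d) * (r * s) = \<psi> (q * p)"
        by (simp only: c d \<psi>_times)
      have "act (c * d) (act' r (act' s x)) = act d (act q (act' s x))"
        by (simp add: mult.commute[of c d] act_times act'[OF act'_closed[OF x] c(2)] act'_closed x)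
      also have "\<dots> = act q (act p x)"
        by (simp add: act_commute[of _ d q] act'[OF x d(2)] act'_closed x)
      finally show "act (c * d) (act' r (act' s x)) = act (q * p) x"
        using x by (simp add: act_times)
    qed (use x in \<open>auto simp: act'_closed\<close>)
  qed
  then show ?thesis using extends that by blast
qed

end


section \<open>The abelian group of a pointed medial Latin quandle\<close>

locale pointed_medial_Latin_quandle =
  fixes Q :: "'q magma" (structure) and e :: 'q
  assumes mlq: "medial_Latin_quandle Q" and base [simp]: "e \<in> carrier Q"
begin

lemma star_closed [simp]: "x \<in> carrier Q \<Longrightarrow> y \<in> carrier Q \<Longrightarrow> x \<star> y \<in> carrier Q"
  using mlq by (auto simp: medial_Latin_quandle_def is_quandle_def is_rack_def is_magma_def)

lemma idem [simp]: "x \<in> carrier Q \<Longrightarrow> x \<star> x = x"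
  using mlq by (auto simp: medial_Latin_quandle_def is_quandle_def)

lemma medial:
  "a \<in> carrier Q \<Longrightarrow> b \<in> carrier Q \<Longrightarrow> c \<in> carrier Q \<Longrightarrow> d \<in> carrier Q \<Longrightarrow>
    (a \<star> b) \<star> (c \<star> d) = (a \<star> c) \<star> (b \<star> d)"
  using mlq by (auto simp: medial_Latin_quandle_def is_medial_def)

lemma bij_left: "x \<in> carrier Q \<Longrightarrow> bij_betw (\<lambda>y. x \<star> y) (carrier Q) (carrier Q)"
  using mlq by (auto simp: medial_Latin_quandle_def is_Latin_def)

lemma bij_right: "x \<in> carrier Q \<Longrightarrow> bij_betw (\<lambda>y. y \<star> x) (carrier Q) (carrier Q)"
  using mlq by (auto simp: medial_Latin_quandle_def is_quandle_def is_rack_def magma_aut_def)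

lemma left_divide:
  assumes "x \<in> carrier Q" "a \<in> carrier Q" obtains y where "y \<in> carrier Q" "a = x \<star> y"
  using bij_left assms by (metis bij_betw_imp_surj_on imageE)

lemma right_divide:
  assumes "x \<in> carrier Q" "a \<in> carrier Q" obtains y where "y \<in> carrier Q" "a = y \<star> x"
  using bij_right assms by (metis bij_betw_imp_surj_on imageE)

lemma base_commute: "x \<in> carrier Q \<Longrightarrow> e \<star> (x \<star> e) = (e \<star> x) \<star> e"
  using medial[of e e x e] by simp

lemma right_base_hom:
  "x \<in> carrier Q \<Longrightarrow> y \<in> carrier Q \<Longrightarrow> (x \<star> y) \<star> e = (x \<star> e) \<star> (y \<star> e)"
  using medial[of x y e e] by simp

lemma left_base_hom:
  "x \<in> carrier Q \<Longrightarrow> y \<in> carrier Q \<Longrightarrow> e \<star> (x \<star> y) = (e \<star> x) \<star> (e \<star> y)"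
  using medial[of e e x y] by simp

text \<open>
  In an Alexander quandle with zero \<open>e\<close> the sum of \<open>x \<star> e\<close> and \<open>e \<star> y\<close> is \<open>x \<star> y\<close>; solving
  \<open>a = x \<star> e\<close> and \<open>b = e \<star> y\<close> gives a formula for \<open>a + b\<close> that makes sense in any Latin quandle.
\<close>

definition grp :: "'q monoid" where
  "grp = \<lparr>carrier = carrier Q,
    mult = (\<lambda>a b. the_inv_into (carrier Q) (\<lambda>x. x \<star> e) a \<star> the_inv_into (carrier Q) (\<lambda>y. e \<star> y) b),
    one = e\<rparr>"

lemma carrier_grp [simp]: "carrier grp = carrier Q"
  by (simp add: grp_def)

lemma one_grp [simp]: "\<one>\<^bsub>grp\<^esub> = e"
  by (simp add: grp_def)

lemma mult_grp:
  assumes "x \<in> carrier Q" "y \<in> carrier Q"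
  shows "(x \<star> e) \<otimes>\<^bsub>grp\<^esub> (e \<star> y) = x \<star> y"
proof -
  have "the_inv_into (carrier Q) (\<lambda>x. x \<star> e) (x \<star> e) = x"
    using bij_right[OF base] assms(1) by (intro the_inv_into_f_f) (auto simp: bij_betw_def)
  moreover have "the_inv_into (carrier Q) (\<lambda>y. e \<star> y) (e \<star> y) = y"
    using bij_left[OF base] assms(2) by (intro the_inv_into_f_f) (auto simp: bij_betw_def)
  ultimately show ?thesis by (simp add: grp_def)
qed

lemma mult_grp_closed:
  assumes "a \<in> carrier Q" "b \<in> carrier Q" shows "a \<otimes>\<^bsub>grp\<^esub> b \<in> carrier Q"
proof -
  obtain x y where "x \<in> carrier Q" "a = x \<star> e" "y \<in> carrier Q" "b = e \<star> y"
    using assms by (metis base left_divide right_divide)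
  then show ?thesis by (simp add: mult_grp)
qed

text \<open>
  The translations at \<open>e\<close> are commuting endomorphisms. After the summands are written as values of
  their composites, both sides are \<open>\<star>\<close>-products of \<open>\<star>\<close>-products, and the law is mediality.
\<close>

lemma grp_interchange:
  assumes "a \<in> carrier Q" "b \<in> carrier Q" "c \<in> carrier Q" "d \<in> carrier Q"
  shows "(a \<otimes>\<^bsub>grp\<^esub> b) \<otimes>\<^bsub>grp\<^esub> (c \<otimes>\<^bsub>grp\<^esub> d) = (a \<otimes>\<^bsub>grp\<^esub> c) \<otimes>\<^bsub>grp\<^esub> (b \<otimes>\<^bsub>grp\<^esub> d)"
proof -
  obtain a' where a: "a' \<in> carrier Q" "a = (a' \<star> e) \<star> e"
    using assms(1) by (metis base right_divide)
  obtain b' where b: "b' \<in> carrier Q" "b = e \<star> (b' \<star> e)"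
    using assms(2) by (metis base left_divide right_divide)
  obtain c' where c: "c' \<in> carrier Q" "c = e \<star> (c' \<star> e)"
    using assms(3) by (metis base left_divide right_divide)
  obtain d' where d: "d' \<in> carrier Q" "d = e \<star> (e \<star> d')"
    using assms(4) by (metis base left_divide)
  have step: "(((x \<star> e) \<star> e) \<otimes>\<^bsub>grp\<^esub> (e \<star> (y \<star> e))) \<otimes>\<^bsub>grp\<^esub>
      ((e \<star> (u \<star> e)) \<otimes>\<^bsub>grp\<^esub> (e \<star> (e \<star> v))) = (x \<star> y) \<star> (u \<star> v)"
    if "x \<in> carrier Q" "y \<in> carrier Q" "u \<in> carrier Q" "v \<in> carrier Q" for x y u v
  proof -
    have "((x \<star> e) \<star> e) \<otimes>\<^bsub>grp\<^esub> (e \<star> (y \<star> e)) = (x \<star> y) \<star> e"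
      using that by (simp add: mult_grp flip: right_base_hom)
    moreover have "(e \<star> (u \<star> e)) \<otimes>\<^bsub>grp\<^esub> (e \<star> (e \<star> v)) = e \<star> (u \<star> v)"
      using that by (simp add: base_commute mult_grp flip: left_base_hom)
    ultimately show ?thesis using that by (simp add: mult_grp)
  qed
  show ?thesis
    using a b c d by (simp add: step medial)
qed

text \<open>
  The Eckmann-Hilton argument: commutativity and associativity are the interchange law with some of
  the four summands equal to the zero \<open>e\<close>. Inverses come from the division in \<open>Q\<close>.
\<close>

lemma comm_group_grp: "comm_group grp"
proof (rule comm_groupI)
  have l_one: "e \<otimes>\<^bsub>grp\<^esub> b = b" if b: "b \<in> carrier Q" for b
  proof -
    obtain y where "y \<in> carrier Q" "b = e \<star> y" using b by (metis base left_divide)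
    then show ?thesis using mult_grp[of e y] by simp
  qed
  have r_one: "a \<otimes>\<^bsub>grp\<^esub> e = a" if a: "a \<in> carrier Q" for a
  proof -
    obtain x where "x \<in> carrier Q" "a = x \<star> e" using a by (metis base right_divide)
    then show ?thesis using mult_grp[of x e] by simp
  qed
  show "x \<otimes>\<^bsub>grp\<^esub> y = y \<otimes>\<^bsub>grp\<^esub> x"
    if "x \<in> carrier grp" "y \<in> carrier grp" for x y
    using grp_interchange[of e x y e] that by (simp add: l_one r_one)
  show "x \<otimes>\<^bsub>grp\<^esub> y \<otimes>\<^bsub>grp\<^esub> z = x \<otimes>\<^bsub>grp\<^esub> (y \<otimes>\<^bsub>grp\<^esub> z)"
    if "x \<in> carrier grp" "y \<in> carrier grp" "z \<in> carrier grp" for x y z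
    using grp_interchange[of x y e z] that by (simp add: l_one r_one)
  show "\<exists>y\<in>carrier grp. y \<otimes>\<^bsub>grp\<^esub> x = \<one>\<^bsub>grp\<^esub>" if "x \<in> carrier grp" for x
  proof -
    have "x \<in> carrier Q" using that by simp
    then obtain y where y: "y \<in> carrier Q" "x = e \<star> y" by (rule left_divide[OF base])
    obtain u where u: "u \<in> carrier Q" "e = u \<star> y"
      by (rule right_divide[OF y(1) base])
    have "(u \<star> e) \<otimes>\<^bsub>grp\<^esub> x = \<one>\<^bsub>grp\<^esub>"
      using mult_grp[OF u(1) y(1)] by (simp flip: y(2) u(2))
    then show ?thesis
      using u by (metis base carrier_grp star_closed)
  qed
  show "\<one>\<^bsub>grp\<^esub> \<otimes>\<^bsub>grp\<^esub> x = x" if "x \<in> carrier grp" for x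
    using that by (simp add: l_one)
qed (auto simp: mult_grp_closed)

sublocale grp: comm_group grp
  by (rule comm_group_grp)

lemma right_base_grp_hom: "(\<lambda>x. x \<star> e) \<in> hom grp grp"
proof (rule homI)
  fix a b assume "a \<in> carrier grp" "b \<in> carrier grp"
  then have ab: "a \<in> carrier Q" "b \<in> carrier Q" by simp_all
  obtain x where x: "x \<in> carrier Q" "a = x \<star> e" by (rule right_divide[OF base ab(1)])
  obtain y where y: "y \<in> carrier Q" "b = e \<star> y" by (rule left_divide[OF base ab(2)])
  have "(a \<otimes>\<^bsub>grp\<^esub> b) \<star> e = (x \<star> e) \<star> (y \<star> e)"
    using x y by (simp add: mult_grp right_base_hom[of x y])
  also have "\<dots> = (a \<star> e) \<otimes>\<^bsub>grp\<^esub> (b \<star> e)"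
    using x y by (simp add: mult_grp flip: base_commute)
  finally show "(a \<otimes>\<^bsub>grp\<^esub> b) \<star> e = (a \<star> e) \<otimes>\<^bsub>grp\<^esub> (b \<star> e)" .
qed auto

lemma right_left_base: "x \<in> carrier Q \<Longrightarrow> (x \<star> e) \<otimes>\<^bsub>grp\<^esub> (e \<star> x) = x"
  by (simp add: mult_grp)

text \<open>
  Idempotence says that \<open>x = (x \<star> e) + (e \<star> x)\<close>, so the two translations at \<open>e\<close> add up to the
  identity.
\<close>

lemma left_base_act:
  assumes "ring_action grp act" "\<And>x. x \<in> carrier Q \<Longrightarrow> act c x = x \<star> e" "x \<in> carrier Q"
  shows "act (1 - c) x = e \<star> x"
proof -
  interpret ring_action grp act by fact
  have "(x \<star> e) \<otimes>\<^bsub>grp\<^esub> act (1 - c) x = x"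
    using act_add[of x c "1 - c"] assms(2,3) by simp
  then have "(x \<star> e) \<otimes>\<^bsub>grp\<^esub> act (1 - c) x = (x \<star> e) \<otimes>\<^bsub>grp\<^esub> (e \<star> x)"
    using assms(3) by (simp add: mult_grp)
  then show ?thesis
    using assms(3) act_closed[of x "1 - c"] by simp
qed

end


section \<open>Alexander quandles of free modules\<close>

interpretation fscale: module fscale
  by (rule module_fscale)

context module
begin

lemma diff_scale: "v - scale c v = scale (1 - c) v"
  by (simp add: scale_left_diff_distrib)

lemma medial_Latin_Alex:
  assumes A: "subspace A" and "c * c' = 1" and "(1 - c) * d = 1"
  shows "medial_Latin_quandle (Alex A (scale c))"
proof -
  have c: "scale c (scale c' v) = v" "scale c' (scale c v) = v" for v
    using assms(2) by (simp_all add: mult.commute)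
  have d: "scale (1 - c) (scale d v) = v" "scale d (scale (1 - c) v) = v" for v
    using assms(3) by (simp_all add: mult.commute[of d])
  note closed = subspace_add[OF A] subspace_diff[OF A] subspace_scale[OF A]
  note dist = scale_right_distrib scale_right_diff_distrib
  have right: "bij_betw (\<lambda>y. scale c y + (x - scale c x)) A A" if "x \<in> A" for x
    by (rule bij_betw_byWitness[where f' = "\<lambda>w. scale c' (w - (x - scale c x))"])
      (auto simp: c that closed simp del: scale_scale)
  have left: "bij_betw (\<lambda>y. scale c x + (y - scale c y)) A A" if "x \<in> A" for x
    by (rule bij_betw_byWitness[where f' = "\<lambda>w. scale d (w - scale c x)"])
      (auto simp: d that closed diff_scale simp del: scale_scale)
  have magma: "is_magma (Alex A (scale c))"
    by (auto simp: is_magma_def Alex_def closed)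
  have "(\<lambda>y. y \<star>\<^bsub>Alex A (scale c)\<^esub> x) \<in> magma_aut (Alex A (scale c))" if "x \<in> A" for x
    using that right[OF that]
    by (auto simp: magma_aut_def magma_hom_def Alex_def closed dist algebra_simps)
  then have "is_quandle (Alex A (scale c))"
    using magma by (auto simp: is_quandle_def is_rack_def Alex_def)
  moreover have "is_medial (Alex A (scale c))"
    by (auto simp: is_medial_def Alex_def dist algebra_simps)
  moreover have "is_Latin (Alex A (scale c))"
    using left by (auto simp: is_Latin_def Alex_def)
  ultimately show ?thesis by (simp add: medial_Latin_quandle_def)
qed

end

text \<open>
  Splitting off one basis element at a time; the summands have to stay in the submodule because
  nothing is known about maps outside it.
\<close>

lemma FAM_induct [consumes 1, case_names zero single add]:
  assumes "v \<in> FAM X z"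
    and zero: "P 0"
    and single: "\<And>x r. x \<in> X - {z} \<Longrightarrow> P (Poly_Mapping.single x r)"
    and add: "\<And>u v. u \<in> FAM X z \<Longrightarrow> v \<in> FAM X z \<Longrightarrow> P u \<Longrightarrow> P v \<Longrightarrow> P (u + v)"
  shows "P v"
proof -
  have "P v" if "finite K" "K \<subseteq> X - {z}" "Poly_Mapping.keys v \<subseteq> K" for K v
    using that
  proof (induction K arbitrary: v)
    case empty
    then show ?case using zero by simp
  next
    case (insert x K)
    define s where "s = Poly_Mapping.single x (Poly_Mapping.lookup v x)"
    have s: "Poly_Mapping.lookup s y = (if y = x then Poly_Mapping.lookup v x else 0)" for y
      by (simp add: s_def lookup_single when_def)
    have keys: "Poly_Mapping.keys (v - s) \<subseteq> K"
      using insert.prems by (auto simp: in_keys_iff lookup_minus s split: if_splits)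
    then have "P (v - s)" using insert by blast
    moreover have "P s" using insert.prems single by (auto simp: s_def)
    moreover have "s \<in> FAM X z" using insert.prems by (auto simp: mem_FAM_iff s)
    moreover have "v - s \<in> FAM X z" using insert.prems keys by (auto simp: FAM_def)
    ultimately show ?case using add[of "v - s" s] by simp
  qed
  from this[OF finite_keys, of v v] show ?thesis using assms(1) by (simp add: FAM_def)
qed

lemma single_in_FAM: "x \<in> X - {z} \<Longrightarrow> Poly_Mapping.single x r \<in> FAM X z"
  by (auto simp: mem_FAM_iff lookup_single when_def)

lemma fscale_single: "fscale r (Poly_Mapping.single x s) = Poly_Mapping.single x (r * s)"
  by (rule poly_mapping_eqI) (simp add: lookup_fscale lookup_single when_def)

lemmas FAM_closed [simp] =
  fscale.subspace_0[OF subspace_FAM] fscale.subspace_add[OF subspace_FAM]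
  fscale.subspace_diff[OF subspace_FAM] fscale.subspace_scale[OF subspace_FAM]

lemma FAM_incl_in_FAM: "x \<in> X \<Longrightarrow> FAM_incl z x \<in> FAM X z"
  by (simp add: FAM_incl_def single_in_FAM)

lemma inj_FAM_incl: "inj_on (FAM_incl z :: 'a \<Rightarrow> 'a \<Rightarrow>\<^sub>0 'r::comm_ring_1) X"
proof (rule inj_onI)
  fix x y assume "FAM_incl z x = (FAM_incl z y :: 'a \<Rightarrow>\<^sub>0 'r)"
  then have "Poly_Mapping.lookup (FAM_incl z x :: 'a \<Rightarrow>\<^sub>0 'r) u = Poly_Mapping.lookup (FAM_incl z y) u" for u
    by simp
  from this[of x] this[of y] show "x = y"
    by (auto simp: FAM_incl_def lookup_single when_def split: if_splits)
qed


section \<open>Homomorphisms out of the Alexander quandle of a free module\<close>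

text \<open>
  The smallest subring that contains \<open>c\<close> and the inverse of each of its elements that is a unit is
  the whole ring. As an induction principle this spares the construction of the subring.
\<close>

definition generates_with_inverses :: "'r::comm_ring_1 \<Rightarrow> bool" where
  "generates_with_inverses c \<longleftrightarrow>
    (\<forall>S. 1 \<in> S \<longrightarrow> c \<in> S \<longrightarrow> (\<forall>a\<in>S. \<forall>b\<in>S. a - b \<in> S \<and> a * b \<in> S) \<longrightarrow>
      (\<forall>a\<in>S. \<forall>b. a * b = 1 \<longrightarrow> b \<in> S) \<longrightarrow> S = UNIV)"

locale quandle_action = pointed_medial_Latin_quandle Q e + ring_action grp act
  for Q :: "'q magma" (structure) and e and act :: "'r::comm_ring_1 \<Rightarrow> 'q \<Rightarrow> 'q" +
  fixes c :: 'r
  assumes act_c: "x \<in> carrier Q \<Longrightarrow> act c x = x \<star> e"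
begin

lemma closed [simp]:
  "x \<in> carrier Q \<Longrightarrow> act r x \<in> carrier Q"
  "x \<in> carrier Q \<Longrightarrow> y \<in> carrier Q \<Longrightarrow> x \<otimes>\<^bsub>grp\<^esub> y \<in> carrier Q"
  using act_closed grp.m_closed by simp_all

lemma act_diff_c: "x \<in> carrier Q \<Longrightarrow> act (1 - c) x = e \<star> x"
  using ring_action_axioms act_c by (rule left_base_act)

lemma star_eq: "x \<in> carrier Q \<Longrightarrow> y \<in> carrier Q \<Longrightarrow> x \<star> y = act c x \<otimes>\<^bsub>grp\<^esub> act (1 - c) y"
  by (simp add: act_c act_diff_c mult_grp)

definition linear_on :: "('x \<Rightarrow>\<^sub>0 'r) set \<Rightarrow> (('x \<Rightarrow>\<^sub>0 'r) \<Rightarrow> 'q) \<Rightarrow> bool" where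
  "linear_on V h \<longleftrightarrow> h \<in> V \<rightarrow> carrier Q \<and>
    (\<forall>u\<in>V. \<forall>v\<in>V. h (u + v) = h u \<otimes>\<^bsub>grp\<^esub> h v) \<and> (\<forall>r. \<forall>v\<in>V. h (fscale r v) = act r (h v))"

lemma linear_imp_hom:
  assumes "linear_on (FAM X z) h"
  shows "h \<in> magma_hom (Alex (FAM X z) (fscale c)) Q"
  using assms
  by (auto simp: linear_on_def magma_hom_def Alex_def fscale.diff_scale star_eq Pi_iff)

text \<open>
  A homomorphism preserving the base points commutes with the two translations at the base
  point, hence with the addition that they determine. It is then linear over \<open>1\<close> and \<open>c\<close>, and the
  scalars over which it is linear are closed under everything that generates the ring.
\<close>

lemma hom_imp_linear:
  fixes h :: "('x \<Rightarrow>\<^sub>0 'r) \<Rightarrow> 'q"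
  assumes hom: "h \<in> magma_hom (Alex (FAM X z) (fscale c)) Q" and base: "h 0 = e"
    and c': "c * c' = 1" and d: "(1 - c) * d = 1" and gen: "generates_with_inverses c"
  shows "linear_on (FAM X z) h"
proof -
  let ?V = "FAM X z :: ('x \<Rightarrow>\<^sub>0 'r) set"
  have h_closed [simp]: "h v \<in> carrier Q" if "v \<in> ?V" for v
    using hom that by (auto simp: magma_hom_def Alex_def)
  have h_star: "h (fscale c u + fscale (1 - c) v) = h u \<star> h v" if "u \<in> ?V" "v \<in> ?V" for u v
    using hom that by (auto simp: magma_hom_def Alex_def fscale.diff_scale)
  have h_c: "h (fscale c u) = h u \<star> e" if "u \<in> ?V" for u
    using h_star[OF that, of 0] base by simp
  have h_d: "h (fscale (1 - c) v) = e \<star> h v" if "v \<in> ?V" for v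
    using h_star[of 0 v] that base by simp
  have h_add: "h (u + v) = h u \<otimes>\<^bsub>grp\<^esub> h v" if uv: "u \<in> ?V" "v \<in> ?V" for u v
  proof -
    define u' v' where "u' = fscale c' u" and "v' = fscale d v"
    have V: "u' \<in> ?V" "v' \<in> ?V" using uv by (simp_all add: u'_def v'_def)
    have "u = fscale c u'" "v = fscale (1 - c) v'" using c' d by (simp_all add: u'_def v'_def)
    then show ?thesis using V by (simp add: h_star h_c h_d mult_grp)
  qed
  define S where "S = {r. \<forall>v\<in>?V. h (fscale r v) = act r (h v)}"
  have "S = UNIV"
  proof (rule gen[unfolded generates_with_inverses_def, rule_format])
    show "1 \<in> S" by (simp add: S_def)
    show "c \<in> S" by (simp add: S_def h_c act_c)
    fix a b assume ab: "a \<in> S" "b \<in> S"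
    have "a * b \<in> S" using ab by (simp add: S_def act_times flip: fscale.scale_scale)
    moreover have "h (fscale (a - b) v) = act (a - b) (h v)" if v: "v \<in> ?V" for v
    proof -
      have "h (fscale (a - b) v) \<otimes>\<^bsub>grp\<^esub> h (fscale b v) = h (fscale a v)"
        using v by (simp flip: h_add fscale.scale_left_distrib)
      also have "\<dots> = act (a - b) (h v) \<otimes>\<^bsub>grp\<^esub> h (fscale b v)"
        using ab v act_add[of "h v" "a - b" b] by (simp add: S_def)
      finally show ?thesis using v by simp
    qed
    ultimately show "a - b \<in> S \<and> a * b \<in> S" by (simp add: S_def)
  next
    fix a b :: 'r assume a: "a \<in> S" and ab: "a * b = 1"
    have "act b (h v) = h (fscale b v)" if v: "v \<in> ?V" for v
    proof -
      have "h (fscale a (fscale b v)) = act a (h (fscale b v))"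
        using a FAM_closed(4)[OF v, of b] unfolding S_def by blast
      then have "h v = act a (h (fscale b v))" using ab by simp
      then show ?thesis using v ab by (simp add: mult.commute[of b] flip: act_times)
    qed
    then show "b \<in> S" by (simp add: S_def)
  qed
  then show ?thesis
    using h_add by (auto simp: linear_on_def S_def)
qed

definition linear_extension :: "('x \<Rightarrow> 'q) \<Rightarrow> ('x \<Rightarrow>\<^sub>0 'r) \<Rightarrow> 'q" where
  "linear_extension f v =
    finprod grp (\<lambda>x. act (Poly_Mapping.lookup v x) (f x)) (Poly_Mapping.keys v)"

context
  fixes X :: "'x set" and z and f :: "'x \<Rightarrow> 'q"
  assumes f: "f \<in> X - {z} \<rightarrow> carrier Q"
begin

lemma linear_extension_eq:
  assumes "finite K" "K \<subseteq> X - {z}" "Poly_Mapping.keys v \<subseteq> K"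
  shows "linear_extension f v = finprod grp (\<lambda>x. act (Poly_Mapping.lookup v x) (f x)) K"
proof -
  have "f x \<in> carrier Q" if "x \<in> K" for x using f assms(2) that by auto
  then show ?thesis
    unfolding linear_extension_def using assms
    by (intro grp.finprod_mono_neutral_cong_left) (auto simp: in_keys_iff)
qed

lemma linear_extension_linear: "linear_on (FAM X z) (linear_extension f)"
  unfolding linear_on_def
proof (intro conjI ballI allI funcsetI)
  fix v :: "'x \<Rightarrow>\<^sub>0 'r" assume v: "v \<in> FAM X z"
  have f_keys: "f x \<in> carrier Q" if "x \<in> Poly_Mapping.keys w" "w \<in> FAM X z"
    for x and w :: "'x \<Rightarrow>\<^sub>0 'r"
    using f that by (auto simp: FAM_def)
  note f_v [simp] = f_keys[OF _ v]
  have "linear_extension f v \<in> carrier grp"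
    unfolding linear_extension_def using v by (intro grp.finprod_closed) auto
  then show "linear_extension f v \<in> carrier Q" by simp
  {
    fix u :: "'x \<Rightarrow>\<^sub>0 'r" assume u: "u \<in> FAM X z"
    note f_u [simp] = f_keys[OF _ u]
    let ?K = "Poly_Mapping.keys u \<union> Poly_Mapping.keys v"
    have K: "finite ?K" "?K \<subseteq> X - {z}" using u v by (auto simp: FAM_def)
    have "linear_extension f (u + v) =
        finprod grp (\<lambda>x. act (Poly_Mapping.lookup (u + v) x) (f x)) ?K"
      using K by (rule linear_extension_eq) (rule keys_add)
    also have "\<dots> = finprod grp (\<lambda>x. act (Poly_Mapping.lookup u x) (f x) \<otimes>\<^bsub>grp\<^esub>
        act (Poly_Mapping.lookup v x) (f x)) ?K"
      using u v by (intro grp.finprod_cong') (auto simp: lookup_add act_add)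
    also have "\<dots> = linear_extension f u \<otimes>\<^bsub>grp\<^esub> linear_extension f v"
      using u v by (subst grp.finprod_multf) (auto simp: linear_extension_eq[OF K])
    finally show "linear_extension f (u + v) = linear_extension f u \<otimes>\<^bsub>grp\<^esub> linear_extension f v" .
  }
  fix r
  let ?K = "Poly_Mapping.keys v"
  have K: "finite ?K" "?K \<subseteq> X - {z}" using v by (auto simp: FAM_def)
  have act_finprod: "act r (finprod grp g K) = finprod grp (\<lambda>x. act r (g x)) K"
    if "finite K" "g \<in> K \<rightarrow> carrier Q" for K and g :: "'x \<Rightarrow> 'q"
    using that
  proof (induction K)
    case empty
    then show ?case using act_unit by simp
  next
    case (insert x K)
    then have "finprod grp g K \<in> carrier grp" by (intro grp.finprod_closed) auto
    then show ?case using insert by (auto simp: act_mult Pi_iff)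
  qed
  have "linear_extension f (fscale r v) =
      finprod grp (\<lambda>x. act (Poly_Mapping.lookup (fscale r v) x) (f x)) ?K"
    using K by (rule linear_extension_eq) (auto simp: in_keys_iff lookup_fscale)
  also have "\<dots> = finprod grp (\<lambda>x. act r (act (Poly_Mapping.lookup v x) (f x))) ?K"
    using v by (intro grp.finprod_cong') (auto simp: lookup_fscale act_times)
  also have "\<dots> = act r (linear_extension f v)"
    unfolding linear_extension_def using v by (subst act_finprod) auto
  finally show "linear_extension f (fscale r v) = act r (linear_extension f v)" .
qed

lemma linear_extension_single:
  assumes "x \<in> X - {z}"
  shows "linear_extension f (Poly_Mapping.single x 1) = f x"
proof -
  have "linear_extension f (Poly_Mapping.single x 1) =
      finprod grp (\<lambda>y. act (Poly_Mapping.lookup (Poly_Mapping.single x 1) y) (f y)) {x}"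
    using assms by (intro linear_extension_eq) auto
  moreover have "f x \<in> carrier Q" using f assms by auto
  ultimately show ?thesis by simp
qed

end

end

text \<open>
  The universal property, for any coefficient ring that acts on the test quandles with \<open>c\<close> acting
  as the right translation at the base point. The base point is the prescribed value at
  \<open>z\<close>, because \<open>z\<close> goes to \<open>0\<close>; homomorphisms that preserve it are the linear maps, and
  these are determined freely by the basis.
\<close>

lemma universal_for_Alex:
  fixes c :: "'r::comm_ring_1" and X :: "'x set" and C :: "'q magma \<Rightarrow> bool"
  assumes z: "z \<in> X" and c': "c * c' = 1" and d: "(1 - c) * d = 1"
    and gen: "generates_with_inverses c"
    and acts: "\<And>Q e. C Q \<Longrightarrow> e \<in> carrier Q \<Longrightarrow> \<exists>act. quandle_action Q e act c"
  shows "universal_for C X (Alex (FAM X z) (fscale c)) (FAM_incl z)"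
  unfolding universal_for_def
proof (intro allI impI)
  fix Q :: "'q magma" and f assume Q: "C Q" and f: "f \<in> X \<rightarrow> carrier Q"
  let ?V = "FAM X z :: ('x \<Rightarrow>\<^sub>0 'r) set"
  let ?F = "Alex ?V (fscale c)"
  define e where "e = f z"
  have "e \<in> carrier Q" using f z by (auto simp: e_def)
  then obtain act where "quandle_action Q e act c" using acts[OF Q] by blast
  then interpret quandle_action Q e act c .
  have f': "f \<in> X - {z} \<rightarrow> carrier Q" using f by auto
  have F [simp]: "carrier ?F = ?V" by (simp add: Alex_def)
  show "\<exists>!h. h \<in> magma_hom ?F Q \<and> h \<in> extensional (carrier ?F) \<and> (\<forall>x\<in>X. h (FAM_incl z x) = f x)"
  proof (rule ex_ex1I)
    let ?h = "restrict (linear_extension f) ?V"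
    have "linear_on ?V (linear_extension f)" using f' by (rule linear_extension_linear)
    then have "linear_on ?V ?h" by (auto simp: linear_on_def)
    then have "?h \<in> magma_hom ?F Q" by (rule linear_imp_hom)
    moreover have "?h (FAM_incl z x) = f x" if "x \<in> X" for x
      using that FAM_incl_in_FAM[of x X z, where 'b = 'r] linear_extension_single[OF f', of x]
      by (auto simp: FAM_incl_def e_def[symmetric] linear_extension_def)
    ultimately show "\<exists>h. h \<in> magma_hom ?F Q \<and> h \<in> extensional (carrier ?F) \<and>
        (\<forall>x\<in>X. h (FAM_incl z x) = f x)"
      by (intro exI[of _ ?h]) auto
  next
    fix h h'
    assume h: "h \<in> magma_hom ?F Q \<and> h \<in> extensional (carrier ?F) \<and> (\<forall>x\<in>X. h (FAM_incl z x) = f x)"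
      and h': "h' \<in> magma_hom ?F Q \<and> h' \<in> extensional (carrier ?F) \<and> (\<forall>x\<in>X. h' (FAM_incl z x) = f x)"
    have linear: "linear_on ?V g"
      if "g \<in> magma_hom ?F Q" "\<forall>x\<in>X. g (FAM_incl z x) = f x" for g
      using that z by (intro hom_imp_linear[OF _ _ c' d gen]) (auto simp: FAM_incl_def e_def)
    have l: "linear_on ?V h" "linear_on ?V h'" using h h' linear by auto
    show "h = h'"
    proof (rule extensionalityI)
      show "h \<in> extensional ?V" "h' \<in> extensional ?V" using h h' by auto
      fix v assume "v \<in> ?V"
      then show "h v = h' v"
      proof (induction v rule: FAM_induct)
        case zero
        have "h (FAM_incl z z) = h' (FAM_incl z z)" using h h' z by simp
        then show ?case by (simp add: FAM_incl_def)
      next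
        case (single x r)
        have v: "Poly_Mapping.single x 1 \<in> ?V" using single by (rule single_in_FAM)
        have "h (FAM_incl z x) = h' (FAM_incl z x)" using h h' single by simp
        then have "h (Poly_Mapping.single x 1) = h' (Poly_Mapping.single x 1)"
          using single by (simp add: FAM_incl_def)
        then have "h (fscale r (Poly_Mapping.single x 1)) = h' (fscale r (Poly_Mapping.single x 1))"
          using l v by (simp add: linear_on_def)
        then show ?case by (simp add: fscale_single)
      next
        case (add u v)
        then show ?case using l by (simp add: linear_on_def)
      qed
    qed
  qed
qed


section \<open>The action of the localized polynomial ring\<close>

definition loc_of_poly :: "int poly \<Rightarrow> loc_ring" where
  "loc_of_poly p = Abs_loc_ring (Fract p 1)"

lemma fract_of_loc_of_poly [simp]: "fract_of_loc (loc_of_poly p) = Fract p 1"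
  unfolding loc_of_poly_def
  by (rule Abs_loc_ring_inverse, simp, rule exI[of _ p], rule exI[of _ 0], rule exI[of _ 0]) simp

lemma loc_of_poly_add: "loc_of_poly (p + q) = loc_of_poly p + loc_of_poly q"
  by (rule fract_of_loc_inject[THEN iffD1]) (simp add: plus_loc_ring.rep_eq)

lemma loc_of_poly_times: "loc_of_poly (p * q) = loc_of_poly p * loc_of_poly q"
  by (rule fract_of_loc_inject[THEN iffD1]) (simp add: times_loc_ring.rep_eq)

lemma loc_of_poly_one: "loc_of_poly 1 = 1"
  by (rule fract_of_loc_inject[THEN iffD1]) (simp add: one_loc_ring.rep_eq One_fract_def)

lemma loc_of_poly_X: "loc_of_poly [:0, 1:] = loc_t"
  by (rule fract_of_loc_inject[THEN iffD1]) (simp add: loc_t.rep_eq)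

lemma one_minus_X: "1 - [:0, 1:] = ([:1, -1:] :: int poly)"
  by (simp add: one_pCons)

lemma loc_of_poly_one_minus_X: "loc_of_poly [:1, -1:] = 1 - loc_t"
proof -
  have "loc_of_poly [:1, -1:] + loc_t = 1"
    by (simp add: one_pCons flip: loc_of_poly_X loc_of_poly_one loc_of_poly_add)
  then show ?thesis by (simp add: eq_diff_eq)
qed

lemma inj_loc_of_poly: "inj loc_of_poly"
proof (rule injI)
  fix p q assume "loc_of_poly p = loc_of_poly q"
  then have "Fract p 1 = Fract q 1" by (metis fract_of_loc_of_poly)
  then show "p = q" by (simp add: eq_fract)
qed

lemma loc_ring_fraction:
  obtains p m n where "loc_of_poly ([:0, 1:] ^ m * [:1, -1:] ^ n) * s = loc_of_poly p"
proof -
  obtain p m n where s: "fract_of_loc s = Fract p ([:0, 1:] ^ m * [:1, -1:] ^ n)"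
    using fract_of_loc[of s] by blast
  define d :: "int poly" where "d = [:0, 1:] ^ m * [:1, -1:] ^ n"
  have "d \<noteq> 0" unfolding d_def by (rule loc_den_nonzero)
  then have "Fract d 1 * fract_of_loc s = Fract p 1"
    unfolding s d_def[symmetric] by (simp add: eq_fract)
  then have "loc_of_poly d * s = loc_of_poly p"
    by (intro fract_of_loc_inject[THEN iffD1]) (simp add: times_loc_ring.rep_eq)
  then show ?thesis using that unfolding d_def by blast
qed

lemma subring_of_int:
  assumes "1 \<in> S" and diff: "\<And>a b. a \<in> S \<Longrightarrow> b \<in> S \<Longrightarrow> a - b \<in> (S :: 'r::ring_1 set)"
  shows "of_int k \<in> S"
proof -
  have 0: "0 \<in> S" using diff[OF assms(1) assms(1)] by simp
  have add1: "a + 1 \<in> S" if "a \<in> S" for a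
    using diff[OF that diff[OF 0 assms(1)]] by simp
  show ?thesis
    by (induction k rule: int_induct[where k = 0]) (auto simp: 0 add1 diff assms(1))
qed

text \<open>
  The element \<open>t\<close> generates all integer polynomials in \<open>t\<close>, and every denominator is a unit.
\<close>

lemma generates_loc_t: "generates_with_inverses loc_t"
  unfolding generates_with_inverses_def
proof (intro allI impI)
  fix S :: "loc_ring set"
  assume one: "1 \<in> S" and t: "loc_t \<in> S"
    and ring: "\<forall>a\<in>S. \<forall>b\<in>S. a - b \<in> S \<and> a * b \<in> S"
    and inv: "\<forall>a\<in>S. \<forall>b. a * b = 1 \<longrightarrow> b \<in> S"
  have int: "of_int k \<in> S" for k using ring by (intro subring_of_int one) auto
  have add: "a + b \<in> S" if "a \<in> S" "b \<in> S" for a b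
  proof -
    have "0 \<in> S" using int[of 0] by simp
    then have "a - (0 - b) \<in> S" using ring that by blast
    then show ?thesis by simp
  qed
  have const: "loc_of_poly [:k:] = of_int k" for k
  proof (induction k rule: int_induct[where k = 0])
    case base
    show ?case using loc_of_poly_add[of 0 0] by simp
  next
    case (step1 i)
    then show ?case
      using loc_of_poly_add[of "[:i:]" 1] by (simp add: one_pCons flip: loc_of_poly_one)
  next
    case (step2 i)
    then show ?case
      using loc_of_poly_add[of "[:i - 1:]" 1] by (simp add: one_pCons flip: loc_of_poly_one)
  qed
  have poly: "loc_of_poly p \<in> S" for p
  proof (induction p)
    case 0
    then show ?case using const[of 0] int[of 0] by simp
  next
    case (pCons a p)
    have "pCons a p = [:a:] + [:0, 1:] * p" by simp
    then have "loc_of_poly (pCons a p) = of_int a + loc_t * loc_of_poly p"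
      by (simp only: loc_of_poly_add loc_of_poly_times loc_of_poly_X const)
    then show ?case using pCons t ring int add by simp
  qed
  have unit_times: "a * b dvd 1" if "a dvd 1" "b dvd 1" for a b :: loc_ring
    using mult_dvd_mono[OF that] by simp
  have unit_power: "loc_of_poly (q ^ k) dvd 1" if "loc_of_poly q dvd 1" for q k
    using that by (induction k) (auto simp: loc_of_poly_one loc_of_poly_times unit_times)
  have "s \<in> S" for s
  proof -
    obtain p m n where s: "loc_of_poly ([:0, 1:] ^ m * [:1, -1:] ^ n) * s = loc_of_poly p"
      using loc_ring_fraction .
    have "loc_of_poly ([:0, 1:] ^ m) dvd 1"
      by (rule unit_power) (simp only: loc_of_poly_X loc_t_unit)
    moreover have "loc_of_poly ([:1, -1:] ^ n) dvd 1"
      by (rule unit_power) (simp only: loc_of_poly_one_minus_X one_minus_loc_t_unit)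
    ultimately have "loc_of_poly ([:0, 1:] ^ m * [:1, -1:] ^ n) dvd 1"
      unfolding loc_of_poly_times by (rule unit_times)
    then obtain u where u: "1 = loc_of_poly ([:0, 1:] ^ m * [:1, -1:] ^ n) * u"
      by (rule dvdE)
    have "s = (loc_of_poly ([:0, 1:] ^ m * [:1, -1:] ^ n) * u) * s"
      by (simp only: u[symmetric] mult_1)
    then have "s = u * loc_of_poly p" by (simp only: s[symmetric] ac_simps)
    moreover have "u \<in> S" using inv[rule_format, OF poly u[symmetric]] .
    ultimately show ?thesis using ring poly by auto
  qed
  then show "S = UNIV" by blast
qed

text \<open>
  The right translation at the base point makes the group a \<open>\<int>[t]\<close>-module; there \<open>1 - t\<close> acts as
  the left translation. Both translations are bijective in a Latin quandle, so the action
  extends to the localization.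
\<close>

lemma loc_ring_action:
  assumes "medial_Latin_quandle Q" "e \<in> carrier Q"
  shows "\<exists>act. quandle_action Q e act loc_t"
proof -
  interpret pointed_medial_Latin_quandle Q e
    using assms by unfold_locales
  define T where "T = (\<lambda>x. x \<star>\<^bsub>Q\<^esub> e)"
  interpret Z: ring_action grp "\<lambda>(k::int) x. x [^]\<^bsub>grp\<^esub> k"
    by (rule grp.int_ring_action)
  have T: "T \<in> hom grp grp" unfolding T_def by (rule right_base_grp_hom)
  have T_pow: "T (x [^]\<^bsub>grp\<^esub> k) = T x [^]\<^bsub>grp\<^esub> k" if "x \<in> carrier grp" for x and k :: int
    using hom_int_pow[OF T that] grp.is_group by simp
  interpret P: ring_action grp "Z.poly_act T"
    by (rule Z.poly_ring_action[OF T T_pow])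
  have X: "Z.poly_act T [:0, 1:] x = x \<star>\<^bsub>Q\<^esub> e" if "x \<in> carrier Q" for x
    using Z.poly_act_X[OF T T_pow, of x] that by (simp add: T_def)
  have one_minus_X: "Z.poly_act T [:1, -1:] x = e \<star>\<^bsub>Q\<^esub> x" if "x \<in> carrier Q" for x
    using left_base_act[OF P.ring_action_axioms X that] by (simp only: one_minus_X)
  have "bij_betw (Z.poly_act T [:0, 1:]) (carrier Q) (carrier Q)"
    using bij_right[OF base] by (rule bij_betw_cong[THEN iffD1, rotated]) (simp add: X)
  moreover have "bij_betw (Z.poly_act T [:1, -1:]) (carrier Q) (carrier Q)"
    using bij_left[OF base] by (rule bij_betw_cong[THEN iffD1, rotated]) (simp add: one_minus_X)
  ultimately have bij: "bij_betw (Z.poly_act T ([:0, 1:] ^ m * [:1, -1:] ^ n)) (carrier grp) (carrier grp)"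
    for m n by (intro P.bij_act_times P.bij_act_power) simp_all
  have fraction: "\<exists>p d. bij_betw (Z.poly_act T d) (carrier grp) (carrier grp) \<and>
      loc_of_poly d * s = loc_of_poly p" for s
    using loc_ring_fraction[of s] bij by metis
  obtain act where act: "ring_action grp act"
    and ext: "\<And>p x. x \<in> carrier grp \<Longrightarrow> act (loc_of_poly p) x = Z.poly_act T p x"
    by (rule P.extend_to_localization[OF inj_loc_of_poly loc_of_poly_add loc_of_poly_times
        loc_of_poly_one fraction]) (rule that, assumption, simp)
  have "act loc_t x = x \<star>\<^bsub>Q\<^esub> e" if "x \<in> carrier Q" for x
    using ext[of x "[:0, 1:]"] X that by (simp add: loc_of_poly_X)
  then have "quandle_action Q e act loc_t"
    using act by (intro quandle_action.intro quandle_action_axioms.intro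
        pointed_medial_Latin_quandle_axioms)
  then show ?thesis by blast
qed


section \<open>The action of the dyadic rationals\<close>

lemma rat_of_dyadic_of_int [simp]: "rat_of_dyadic (of_int k) = of_int k"
  by (induction k rule: int_induct[where k = 0])
    (simp_all add: zero_dyadic.rep_eq one_dyadic.rep_eq plus_dyadic.rep_eq minus_dyadic.rep_eq)

lemma inj_of_int_dyadic: "inj (of_int :: int \<Rightarrow> dyadic)"
  by (rule injI) (metis of_int_eq_iff rat_of_dyadic_of_int)

lemma dyadic_fraction:
  obtains a n where "of_int (2 ^ n) * s = (of_int a :: dyadic)"
proof -
  obtain a n where s: "rat_of_dyadic s = of_int a / 2 ^ n"
    using rat_of_dyadic[of s] by blast
  have "rat_of_dyadic (of_int (2 ^ n) * s) = rat_of_dyadic (of_int a)"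
    by (simp only: times_dyadic.rep_eq rat_of_dyadic_of_int s) simp
  then have "of_int (2 ^ n) * s = of_int a" by (simp only: rat_of_dyadic_inject)
  then show ?thesis using that by blast
qed

lemma two_times_half: "2 * dyadic_half = 1"
  using dyadic_half_plus_half by simp

lemma generates_dyadic_half: "generates_with_inverses dyadic_half"
  unfolding generates_with_inverses_def
proof (intro allI impI)
  fix S :: "dyadic set"
  assume one: "1 \<in> S" and half: "dyadic_half \<in> S"
    and ring: "\<forall>a\<in>S. \<forall>b\<in>S. a - b \<in> S \<and> a * b \<in> S"
  have int: "of_int k \<in> S" for k using ring by (intro subring_of_int one) auto
  have power: "dyadic_half ^ n \<in> S" for n by (induction n) (use one half ring in auto)
  have "s \<in> S" for s
  proof -
    obtain a n where s: "of_int (2 ^ n) * s = of_int a" using dyadic_fraction .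
    have "2 ^ n * dyadic_half ^ n = 1"
      by (simp add: two_times_half flip: power_mult_distrib)
    then have "s = dyadic_half ^ n * (2 ^ n * s)"
      by (metis mult.assoc mult.commute mult_1)
    then have "s = dyadic_half ^ n * of_int a" using s by simp
    then show ?thesis using ring int power by auto
  qed
  then show "S = UNIV" by blast
qed

text \<open>Left translations coincide with right translations, which are bijective in a rack.\<close>

lemma medial_commutative_imp_Latin:
  "medial_commutative_quandle Q \<Longrightarrow> medial_Latin_quandle Q"
  unfolding medial_commutative_quandle_def medial_Latin_quandle_def
  by (auto simp: is_Latin_def is_commutative_def is_quandle_def is_rack_def magma_aut_def
      cong: bij_betw_cong)

text \<open>
  In the commutative case \<open>x = (x \<star> e) + (e \<star> x)\<close> is twice \<open>x \<star> e\<close>. So doubling is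
  invertible and its inverse is the translation at the base point.
\<close>

lemma dyadic_action:
  assumes "medial_commutative_quandle Q" "e \<in> carrier Q"
  shows "\<exists>act. quandle_action Q e act dyadic_half"
proof -
  interpret pointed_medial_Latin_quandle Q e
    using assms medial_commutative_imp_Latin by unfold_locales auto
  have comm: "e \<star>\<^bsub>Q\<^esub> x = x \<star>\<^bsub>Q\<^esub> e" if "x \<in> carrier Q" for x
    using assms that by (auto simp: medial_commutative_quandle_def is_commutative_def)
  have double: "(x \<star>\<^bsub>Q\<^esub> e) \<otimes>\<^bsub>grp\<^esub> (x \<star>\<^bsub>Q\<^esub> e) = x" if "x \<in> carrier Q" for x
    using right_left_base[OF that] comm that by simp
  interpret Z: ring_action grp "\<lambda>(k::int) x. x [^]\<^bsub>grp\<^esub> k"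
    by (rule grp.int_ring_action)
  have two: "x [^]\<^bsub>grp\<^esub> (2::int) = x \<otimes>\<^bsub>grp\<^esub> x" if "x \<in> carrier Q" for x
    using Z.act_add[of x 1 1] that by simp
  have half_double: "(x \<otimes>\<^bsub>grp\<^esub> x) \<star>\<^bsub>Q\<^esub> e = x" if "x \<in> carrier Q" for x
    using right_base_grp_hom double that by (simp add: hom_def)
  have bij_two: "bij_betw (\<lambda>x. x [^]\<^bsub>grp\<^esub> (2::int)) (carrier grp) (carrier grp)"
    by (rule bij_betw_byWitness[where f' = "\<lambda>x. x \<star>\<^bsub>Q\<^esub> e"])
      (auto simp: two double half_double mult_grp_closed)
  have fraction: "\<exists>p d. bij_betw (\<lambda>x. x [^]\<^bsub>grp\<^esub> (d::int)) (carrier grp) (carrier grp) \<and>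
      of_int d * s = (of_int p :: dyadic)" for s
    using dyadic_fraction[of s] Z.bij_act_power[OF bij_two] by metis
  obtain act where act: "ring_action grp act"
    and ext: "\<And>k x. x \<in> carrier grp \<Longrightarrow> act (of_int k :: dyadic) x = x [^]\<^bsub>grp\<^esub> k"
    by (rule Z.extend_to_localization[OF inj_of_int_dyadic of_int_add of_int_mult of_int_1
        fraction]) (rule that, assumption, simp)
  interpret D: ring_action grp act by (rule act)
  have "act dyadic_half x = x \<star>\<^bsub>Q\<^esub> e" if x: "x \<in> carrier Q" for x
  proof -
    have y: "act dyadic_half x \<in> carrier Q" using D.act_closed x by simp
    have "act dyadic_half x \<otimes>\<^bsub>grp\<^esub> act dyadic_half x = x"
      using D.act_add[of x dyadic_half dyadic_half] x by (simp add: dyadic_half_plus_half)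
    then show ?thesis using half_double[OF y] by simp
  qed
  then have "quandle_action Q e act dyadic_half"
    using act by (intro quandle_action.intro quandle_action_axioms.intro
        pointed_medial_Latin_quandle_axioms)
  then show ?thesis by blast
qed


section \<open>The free quandles\<close>

lemma midpoint_quandle_eq_Alex:
  "midpoint_quandle fscale M = Alex M (fscale dyadic_half :: ('a \<Rightarrow>\<^sub>0 dyadic) \<Rightarrow> _)"
proof -
  have "1 - dyadic_half = dyadic_half"
    using dyadic_half_plus_half by (metis add_diff_cancel_right')
  then show ?thesis
    unfolding midpoint_quandle_def Alex_def fscale.diff_scale fscale.scale_right_distrib by (simp only:)
qed

lemma free_medial_Latin:
  assumes "z \<in> X"
  shows "free_medial_Latin_quandle TYPE('q) X
    (Alex (FAM X z :: ('x \<Rightarrow>\<^sub>0 loc_ring) set) (fscale loc_t)) (FAM_incl z)"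
proof -
  obtain c' d where c: "loc_t * c' = 1" and d: "(1 - loc_t) * d = 1"
    using loc_t_unit one_minus_loc_t_unit by (metis dvdE)
  show ?thesis
    unfolding free_medial_Latin_quandle_def
  proof (intro conjI)
    show "medial_Latin_quandle (Alex (FAM X z :: ('x \<Rightarrow>\<^sub>0 loc_ring) set) (fscale loc_t))"
      using subspace_FAM c d by (rule fscale.medial_Latin_Alex)
    show "universal_for medial_Latin_quandle X
        (Alex (FAM X z :: ('x \<Rightarrow>\<^sub>0 loc_ring) set) (fscale loc_t)) (FAM_incl z)"
      by (rule universal_for_Alex[OF assms c d generates_loc_t loc_ring_action])
  qed (auto simp: Alex_def FAM_incl_in_FAM inj_FAM_incl)
qed

lemma free_medial_commutative:
  assumes "z \<in> X"
  shows "free_medial_commutative_quandle TYPE('q) X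
    (midpoint_quandle fscale (FAM X z :: ('x \<Rightarrow>\<^sub>0 dyadic) set)) (FAM_incl z)"
proof -
  have c: "dyadic_half * 2 = 1" and d: "(1 - dyadic_half) * 2 = 1"
    using two_times_half by (simp_all add: algebra_simps)
  let ?F = "midpoint_quandle fscale (FAM X z :: ('x \<Rightarrow>\<^sub>0 dyadic) set)"
  show ?thesis
    unfolding free_medial_commutative_quandle_def
  proof (intro conjI)
    have "medial_Latin_quandle ?F"
      unfolding midpoint_quandle_eq_Alex using subspace_FAM c d by (rule fscale.medial_Latin_Alex)
    moreover have "is_commutative ?F"
      by (auto simp: is_commutative_def midpoint_quandle_def add.commute)
    ultimately show "medial_commutative_quandle ?F"
      by (simp add: medial_Latin_quandle_def medial_commutative_quandle_def)
    show "universal_for medial_commutative_quandle X ?F (FAM_incl z)"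
      unfolding midpoint_quandle_eq_Alex
      by (rule universal_for_Alex[OF assms c d generates_dyadic_half dyadic_action])
  qed (auto simp: midpoint_quandle_def FAM_incl_in_FAM inj_FAM_incl)
qed

text \<open>
  The empty set has exactly one map into each test quandle. Testing against the empty quandle forces
  the carrier to be empty, since only the empty set maps to the empty set.
\<close>

lemma universal_for_empty_iff:
  fixes F :: "'e magma" and C :: "'q magma \<Rightarrow> bool"
  assumes "\<And>Q :: 'q magma. carrier Q = {} \<Longrightarrow> C Q"
  shows "universal_for C {} F i \<longleftrightarrow> carrier F = {}"
proof
  assume u: "universal_for C {} F i"
  define Q :: "'q magma" where "Q = \<lparr>carrier = {}, magop = undefined\<rparr>"
  have "C Q" by (rule assms) (simp add: Q_def)
  then obtain h where "h \<in> magma_hom F Q"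
    using u by (auto simp: universal_for_def)
  then show "carrier F = {}" by (auto simp: magma_hom_def Q_def)
next
  assume "carrier F = {}"
  then show "universal_for C {} F i"
    by (auto simp: universal_for_def magma_hom_def)
qed

lemma empty_medial_Latin: "carrier Q = {} \<Longrightarrow> medial_Latin_quandle Q"
  by (simp add: medial_Latin_quandle_def is_quandle_def is_rack_def is_magma_def is_medial_def
      is_Latin_def)

lemma empty_medial_commutative: "carrier Q = {} \<Longrightarrow> medial_commutative_quandle Q"
  by (simp add: medial_commutative_quandle_def is_quandle_def is_rack_def is_magma_def
      is_medial_def is_commutative_def)

theorem mainTheorem7:
  fixes X :: "'x set"
  shows "(X \<noteq> {} \<longrightarrow> (\<forall>z\<in>X.
            free_medial_Latin_quandle TYPE('q) X
              (Alex (FAM X z :: ('x \<Rightarrow>\<^sub>0 loc_ring) set) (fscale loc_t)) (FAM_incl z) \<and>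
            free_medial_commutative_quandle TYPE('q) X
              (midpoint_quandle fscale (FAM X z :: ('x \<Rightarrow>\<^sub>0 dyadic) set)) (FAM_incl z))) \<and>
         (X = {} \<longrightarrow> (\<forall>(F :: 'e magma) i.
            (free_medial_Latin_quandle TYPE('q) X F i \<longleftrightarrow> carrier F = {}) \<and>
            (free_medial_commutative_quandle TYPE('q) X F i \<longleftrightarrow> carrier F = {})))"
proof (intro conjI impI ballI allI)
  fix z assume "z \<in> X"
  then show "free_medial_Latin_quandle TYPE('q) X
      (Alex (FAM X z :: ('x \<Rightarrow>\<^sub>0 loc_ring) set) (fscale loc_t)) (FAM_incl z)"
    and "free_medial_commutative_quandle TYPE('q) X
      (midpoint_quandle fscale (FAM X z :: ('x \<Rightarrow>\<^sub>0 dyadic) set)) (FAM_incl z)"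
    by (rule free_medial_Latin, rule free_medial_commutative)
next
  fix F :: "'e magma" and i :: "'x \<Rightarrow> 'e"
  assume X: "X = {}"
  show "free_medial_Latin_quandle TYPE('q) X F i \<longleftrightarrow> carrier F = {}"
    using universal_for_empty_iff[where C = medial_Latin_quandle, OF empty_medial_Latin]
      empty_medial_Latin[of F]
    by (auto simp: X free_medial_Latin_quandle_def)
  show "free_medial_commutative_quandle TYPE('q) X F i \<longleftrightarrow> carrier F = {}"
    using universal_for_empty_iff[where C = medial_commutative_quandle, OF empty_medial_commutative]
      empty_medial_commutative[of F]
    by (auto simp: X free_medial_commutative_quandle_def)
qed

end
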